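(* Suppose that $n\ge3$ and that the distribution $F$ on $\mathbb R$ is $n$-completely mixable with mean $0$ and finite positive variance. A random vector with marginals $F$ is a minimizer of $$\text{to minimize}\quad \max_{K\subseteq[n]}\mathbb E\left[\left(\sum_{i\in K}X_i\right)^2\right]\quad\text{subject to } X_i\sim F,\ i\in[n],$$ if and only if it is an NCD joint mix with correlation matrix $P_n^*$. The same conclusion holds true, for any $k\in[n]\setminus\{1,n-1,n\}$, if the problem is replaced by $$\text{to minimize}\quad \max_{K\subseteq[n],\,|K|=k}\mathbb E\left[\left(\sum_{i\in K}X_i\right)^2\right]\quad\text{subject to } X_i\sim F,\ i\in[n].$$
   Context: $[n]=\{1,\dots,n\}$; the sum over the empty set is $0$. Minimizations are over all random vectors $(X_1,\dots,X_n)$ satisfying the constraint. A random vector $(X_1,\dots,X_n)$ is a joint mix if $\sum_{i=1}^nX_i$ is almost surely equal to a constant. $F$ is $n$-completely mixable if there is a joint mix $(X_1,\dots,X_n)$ with $X_i\sim F$ for all $i\in[n]$. A random vector is negative correlation dependent (NCD) if $\mathrm{Cov}(X_i,X_j)\le0$ for all $i\ne j$. $P_n^*$ is the $n\times n$ matrix with diagonal entries $1$ and off-diagonal entries $-1/(n-1)$. *)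

theory Defs
  imports "HOL-Probability.Probability"
begin

definition has_marginals ::
  "nat \<Rightarrow> real measure \<Rightarrow> 'a measure \<Rightarrow> (nat \<Rightarrow> 'a \<Rightarrow> real) \<Rightarrow> bool" where
  "has_marginals n F M X \<longleftrightarrow>
     prob_space M \<and>
     (\<forall>i\<in>{1..n}. X i \<in> borel_measurable M \<and> distr M borel (X i) = F)"

definition joint_mix :: "nat \<Rightarrow> 'a measure \<Rightarrow> (nat \<Rightarrow> 'a \<Rightarrow> real) \<Rightarrow> bool" where
  "joint_mix n M X \<longleftrightarrow> (\<exists>c. AE \<omega> in M. (\<Sum>i\<in>{1..n}. X i \<omega>) = c)"

text \<open>
  HOL cannot quantify over all types inside a formula, so bound random vectors live on
  arbitrary probability spaces over the type \<^typ>\<open>nat \<Rightarrow> real\<close>. Since the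
  law of an n-dimensional random vector is itself such a space, this loses nothing: see
  \<open>completely_mixableI\<close> and \<open>minimizer_le\<close> below.
\<close>

definition completely_mixable :: "nat \<Rightarrow> real measure \<Rightarrow> bool" where
  "completely_mixable n F \<longleftrightarrow>
     (\<exists>(N :: (nat \<Rightarrow> real) measure) Y. has_marginals n F N Y \<and> joint_mix n N Y)"

text \<open>
  The integrals below are genuine second moments when the marginals are square-integrable,
  and the maximum is meaningful for finite nonempty \<open>\<K>\<close>.
\<close>

definition max_sq_sum ::
  "nat set set \<Rightarrow> 'a measure \<Rightarrow> (nat \<Rightarrow> 'a \<Rightarrow> real) \<Rightarrow> real" where
  "max_sq_sum \<K> M X = Max ((\<lambda>K. \<integral>\<omega>. (\<Sum>i\<in>K. X i \<omega>)\<^sup>2 \<partial>M) ` \<K>)"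

definition minimizer ::
  "nat \<Rightarrow> real measure \<Rightarrow> nat set set \<Rightarrow> 'a measure \<Rightarrow> (nat \<Rightarrow> 'a \<Rightarrow> real) \<Rightarrow> bool" where
  "minimizer n F \<K> M X \<longleftrightarrow>
     has_marginals n F M X \<and>
     (\<forall>(N :: (nat \<Rightarrow> real) measure) Y.
        has_marginals n F N Y \<longrightarrow> max_sq_sum \<K> M X \<le> max_sq_sum \<K> N Y)"

definition covariance :: "'a measure \<Rightarrow> ('a \<Rightarrow> real) \<Rightarrow> ('a \<Rightarrow> real) \<Rightarrow> real" where
  "covariance M U V =
     (\<integral>\<omega>. (U \<omega> - (\<integral>\<eta>. U \<eta> \<partial>M)) * (V \<omega> - (\<integral>\<eta>. V \<eta> \<partial>M)) \<partial>M)"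

definition correlation :: "'a measure \<Rightarrow> ('a \<Rightarrow> real) \<Rightarrow> ('a \<Rightarrow> real) \<Rightarrow> real" where
  "correlation M U V =
     covariance M U V / (sqrt (covariance M U U) * sqrt (covariance M V V))"

definition NCD :: "nat \<Rightarrow> 'a measure \<Rightarrow> (nat \<Rightarrow> 'a \<Rightarrow> real) \<Rightarrow> bool" where
  "NCD n M X \<longleftrightarrow>
     (\<forall>i\<in>{1..n}. \<forall>j\<in>{1..n}. i \<noteq> j \<longrightarrow> covariance M (X i) (X j) \<le> 0)"

definition P_star :: "nat \<Rightarrow> nat \<Rightarrow> nat \<Rightarrow> real" where
  "P_star n i j = (if i = j then 1 else - 1 / (real n - 1))"

definition has_correlation_matrix ::
  "nat \<Rightarrow> 'a measure \<Rightarrow> (nat \<Rightarrow> 'a \<Rightarrow> real) \<Rightarrow> (nat \<Rightarrow> nat \<Rightarrow> real) \<Rightarrow> bool" where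
  "has_correlation_matrix n M X R \<longleftrightarrow>
     (\<forall>i\<in>{1..n}. \<forall>j\<in>{1..n}. correlation M (X i) (X j) = R i j)"

lemma has_marginals_transfer:
  fixes M :: "'a measure"
  assumes "has_marginals n F M X"
  obtains N :: "(nat \<Rightarrow> real) measure" and Y
  where "has_marginals n F N Y"
    and "joint_mix n M X \<Longrightarrow> joint_mix n N Y"
    and "\<And>\<K>. \<K> \<subseteq> Pow {1..n} \<Longrightarrow> max_sq_sum \<K> N Y = max_sq_sum \<K> M X"
proof -
  define P where "P = PiM {1..n} (\<lambda>_. borel :: real measure)"
  define T where "T = (\<lambda>\<omega>. \<lambda>i\<in>{1..n}. X i \<omega>)"
  define N where "N = distr M P T"
  define Y where "Y = (\<lambda>i (f :: nat \<Rightarrow> real). f i)"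
  have ps: "prob_space M"
    and X: "\<And>i. i \<in> {1..n} \<Longrightarrow> X i \<in> borel_measurable M"
    and XF: "\<And>i. i \<in> {1..n} \<Longrightarrow> distr M borel (X i) = F"
    using assms by (auto simp: has_marginals_def)
  have T [measurable]: "T \<in> measurable M P"
    unfolding T_def P_def by (rule measurable_restrict) (use X in auto)
  have Y: "Y i \<in> borel_measurable P" if "i \<in> {1..n}" for i
    unfolding Y_def P_def by (rule measurable_component_singleton) (use that in auto)
  have Y_sum: "(\<lambda>f. \<Sum>i\<in>K. Y i f) \<in> borel_measurable P" if "K \<subseteq> {1..n}" for K
    using that Y by (intro borel_measurable_sum) auto
  have sum_T: "(\<Sum>i\<in>K. Y i (T \<omega>)) = (\<Sum>i\<in>K. X i \<omega>)" if "K \<subseteq> {1..n}" for K \<omega>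
    using that by (intro sum.cong) (auto simp: Y_def T_def)
  have "has_marginals n F N Y"
    unfolding has_marginals_def
  proof (intro conjI ballI)
    show "prob_space N"
      unfolding N_def by (rule prob_space.prob_space_distr[OF ps T])
    fix i assume i: "i \<in> {1..n}"
    show "Y i \<in> borel_measurable N"
      using Y[OF i] by (simp add: N_def)
    have "distr N borel (Y i) = distr M borel (Y i \<circ> T)"
      unfolding N_def by (rule distr_distr[OF Y[OF i] T])
    also have "Y i \<circ> T = X i"
      using i by (auto simp: Y_def T_def)
    finally show "distr N borel (Y i) = F"
      using XF[OF i] by simp
  qed
  moreover have "joint_mix n N Y" if mix: "joint_mix n M X"
  proof -
    obtain c where c: "AE \<omega> in M. (\<Sum>i\<in>{1..n}. X i \<omega>) = c"
      using mix by (auto simp: joint_mix_def)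
    have "{f \<in> space P. (\<Sum>i\<in>{1..n}. Y i f) = c} \<in> sets P"
      using borel_measurable_eq[OF Y_sum[OF subset_refl] borel_measurable_const[of c]] by simp
    then have "AE f in N. (\<Sum>i\<in>{1..n}. Y i f) = c"
      unfolding N_def using c by (subst AE_distr_iff[OF T]) (simp_all add: sum_T)
    then show ?thesis
      by (auto simp: joint_mix_def)
  qed
  moreover have "max_sq_sum \<K> N Y = max_sq_sum \<K> M X" if "\<K> \<subseteq> Pow {1..n}" for \<K>
  proof -
    have "(\<integral>f. (\<Sum>i\<in>K. Y i f)\<^sup>2 \<partial>N) = (\<integral>\<omega>. (\<Sum>i\<in>K. X i \<omega>)\<^sup>2 \<partial>M)" if "K \<subseteq> {1..n}" for K
      unfolding N_def
      by (subst integral_distr[OF T borel_measurable_power[OF Y_sum[OF that]]])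
        (simp add: sum_T[OF that])
    then show ?thesis
      unfolding max_sq_sum_def using that by (intro arg_cong[where f = Max] image_cong) auto
  qed
  ultimately show thesis
    by (rule that)
qed

lemma completely_mixableI:
  fixes M :: "'a measure"
  assumes "has_marginals n F M X" "joint_mix n M X"
  shows "completely_mixable n F"
  using assms(2) has_marginals_transfer[OF assms(1)]
  unfolding completely_mixable_def by metis

lemma minimizer_le:
  fixes M :: "'a measure" and N :: "'b measure"
  assumes "minimizer n F \<K> M X" "\<K> \<subseteq> Pow {1..n}" "has_marginals n F N Y"
  shows "max_sq_sum \<K> M X \<le> max_sq_sum \<K> N Y"
  using assms(1,2) has_marginals_transfer[OF assms(3)]
  unfolding minimizer_def by metis

end

theory Submission
  imports Defs "HOL-Combinatorics.Permutations"
begin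

text \<open>
  Write \<open>v\<close> for the variance of \<open>F\<close>, \<open>S\<^sub>K\<close> for the partial sum over
  \<open>K\<close>, and \<open>k = |K|\<close>. Averaging over all permutations of the indices makes
  the covariances exchangeable, which shows that the mean of \<open>E[S\<^sub>K\<^sup>2]\<close> over
  the sets of size \<open>k\<close> is \<open>k (n - k) v / (n - 1)\<close> plus a nonnegative multiple of
  \<open>E[S\<^sub>V\<^sup>2]\<close>, where \<open>V\<close> is the full index set. So the maximum is at least
  \<open>k (n - k) v / (n - 1)\<close>, and a randomly permuted joint mix attains this bound.
  Conversely, attaining it forces \<open>E[S\<^sub>V\<^sup>2] = 0\<close> and makes \<open>E[S\<^sub>K\<^sup>2]\<close>
  constant over the sets of size \<open>k\<close>; exchanging elements of \<open>K\<close> then shows that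
  all covariances agree. For the maximum over all sets, the balanced size
  \<open>k = n - n div 2\<close> dominates.
\<close>

section \<open>Quadratic sums over subsets\<close>

text \<open>For \<open>c = mixed_moment M X\<close> this is the second moment of the partial sum
  over \<open>K\<close>, see \<open>integral_square_sum\<close>. Leaving \<open>c\<close> abstract
  keeps this section purely combinatorial.\<close>

definition quad_sum :: "('b \<Rightarrow> 'b \<Rightarrow> real) \<Rightarrow> 'b set \<Rightarrow> real" where
  "quad_sum c K = (\<Sum>i\<in>K. \<Sum>j\<in>K. c i j)"

text \<open>The moment matrix of a vector whose indices are relabelled by a uniformly random
  permutation, see \<open>mixed_moment_permuted\<close>.\<close>

definition symmetrize :: "'b set \<Rightarrow> ('b \<Rightarrow> 'b \<Rightarrow> real) \<Rightarrow> 'b \<Rightarrow> 'b \<Rightarrow> real" where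
  "symmetrize V c i j = (\<Sum>p | p permutes V. c (p i) (p j)) / card {p. p permutes V}"

text \<open>The second moment of a sum of \<open>k\<close> entries when all diagonal moments are
  \<open>v\<close> and all others are \<open>- v / (n - 1)\<close>.\<close>

definition balanced_bound :: "nat \<Rightarrow> nat \<Rightarrow> real \<Rightarrow> real" where
  "balanced_bound n k v = real k * (real n - real k) / (real n - 1) * v"

section \<open>Averaging over permutations of the indices\<close>

lemma card_permutations_pos:
  assumes "finite V"
  shows "card {p. p permutes V} > 0"
  using card_permutations[OF refl assms] by simp

text \<open>Two transpositions suffice: \<open>t\<close> sends \<open>i\<close> to
  \<open>i'\<close>, and the next one sends \<open>t j\<close> to \<open>j'\<close>. The latter
  fixes \<open>i'\<close> because neither \<open>t j\<close> nor \<open>j'\<close> equals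
  it.\<close>

lemma permutes_pair_exists:
  assumes "i \<in> V" "j \<in> V" "i' \<in> V" "j' \<in> V" "i \<noteq> j" "i' \<noteq> j'"
  obtains p where "p permutes V" "p i = i'" "p j = j'"
proof -
  define t where "t = Transposition.transpose i i'"
  have t: "t permutes V"
    unfolding t_def using assms by (intro permutes_swap_id)
  have "t i = i'" by (simp add: t_def)
  moreover have "t j \<noteq> i'"
    using assms(5) \<open>t i = i'\<close> permutes_inj[OF t] by (metis injD)
  moreover have "t j \<in> V"
    using permutes_in_image[OF t] assms by simp
  moreover have "Transposition.transpose (t j) j' \<circ> t permutes V"
    using assms \<open>t j \<in> V\<close> by (intro permutes_compose[OF t] permutes_swap_id)
  ultimately show thesis
    using assms by (intro that[of "Transposition.transpose (t j) j' \<circ> t"])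
      (auto simp: Transposition.transpose_def)
qed

text \<open>Composing on the right with a fixed permutation \<open>q\<close> only reorders the sum
  over \<open>p\<close>, and \<open>q\<close> can be chosen to carry the first pair to the
  second.\<close>

lemma symmetrize_exchangeable:
  assumes "i \<in> V" "j \<in> V" "i' \<in> V" "j' \<in> V" "i \<noteq> j" "i' \<noteq> j'"
  shows "symmetrize V c i j = symmetrize V c i' j'"
proof -
  obtain q where q: "q permutes V" "q i = i'" "q j = j'"
    using permutes_pair_exists[OF assms] .
  have "(\<Sum>p | p permutes V. c (p i') (p j')) = (\<Sum>p | p permutes V. c (p i) (p j))"
    by (subst (2) sum_permutations_compose_right[OF q(1)],
        subst sum_permutations_compose_right[OF permutes_id])
      (simp add: q)
  then show ?thesis by (simp add: symmetrize_def)
qed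

lemma symmetrize_diag:
  assumes "finite V" "\<And>i. i \<in> V \<Longrightarrow> c i i = v" "i \<in> V"
  shows "symmetrize V c i i = v"
  using assms card_permutations_pos[OF assms(1)]
  by (simp add: symmetrize_def permutes_in_image)

lemma quad_sum_symmetrize:
  "quad_sum (symmetrize V c) K =
    (\<Sum>p | p permutes V. quad_sum c (p ` K)) / card {p. p permutes V}"
proof -
  have "(\<Sum>p | p permutes V. quad_sum c (p ` K)) =
      (\<Sum>p | p permutes V. \<Sum>i\<in>K. \<Sum>j\<in>K. c (p i) (p j))"
    unfolding quad_sum_def
    by (rule sum.cong) (simp_all add: sum.reindex permutes_inj_on)
  also have "\<dots> = (\<Sum>i\<in>K. \<Sum>p | p permutes V. \<Sum>j\<in>K. c (p i) (p j))"
    by (rule sum.swap)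
  also have "\<dots> = (\<Sum>i\<in>K. \<Sum>j\<in>K. \<Sum>p | p permutes V. c (p i) (p j))"
    by (intro sum.cong refl sum.swap)
  finally show ?thesis
    by (simp add: quad_sum_def symmetrize_def sum_divide_distrib)
qed

lemma quad_sum_const:
  assumes "finite K" "\<And>i. i \<in> K \<Longrightarrow> c i i = v"
    and "\<And>i j. i \<in> K \<Longrightarrow> j \<in> K \<Longrightarrow> i \<noteq> j \<Longrightarrow> c i j = a"
  shows "quad_sum c K = real (card K) * v + real (card K) * (real (card K) - 1) * a"
proof -
  have row: "(\<Sum>j\<in>K. c i j) = v + (real (card K) - 1) * a" if i: "i \<in> K" for i
  proof -
    have "card K > 0" using i assms(1) by (auto simp: card_gt_0_iff)
    have "(\<Sum>j\<in>K. c i j) = c i i + (\<Sum>j\<in>K - {i}. c i j)"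
      using assms(1) i by (rule sum.remove)
    also have "(\<Sum>j\<in>K - {i}. c i j) = (\<Sum>j\<in>K - {i}. a)"
      using assms(3)[OF i] by (intro sum.cong) auto
    finally show ?thesis
      using assms(1,2) i \<open>card K > 0\<close> by (simp add: of_nat_diff)
  qed
  have "quad_sum c K = (\<Sum>i\<in>K. v + (real (card K) - 1) * a)"
    unfolding quad_sum_def by (intro sum.cong refl row)
  then show ?thesis
    by (simp add: algebra_simps)
qed

lemma quad_sum_eq_balanced_bound:
  assumes "finite K" "n \<ge> 2" "\<And>i. i \<in> K \<Longrightarrow> c i i = v"
    and "\<And>i j. i \<in> K \<Longrightarrow> j \<in> K \<Longrightarrow> i \<noteq> j \<Longrightarrow> c i j = - v / (real n - 1)"
  shows "quad_sum c K = balanced_bound n (card K) v"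
proof -
  define d where "d = real n - 1"
  have "real n = d + 1" "d \<noteq> 0" using assms(2) by (auto simp: d_def)
  moreover have "quad_sum c K =
      real (card K) * v + real (card K) * (real (card K) - 1) * (- v / d)"
    using quad_sum_const[where c = c, OF assms(1,3,4)] by (simp add: d_def)
  ultimately show ?thesis
    by (simp add: balanced_bound_def divide_simps) (simp add: algebra_simps)
qed

text \<open>The symmetrized matrix has diagonal \<open>v\<close> and a single off-diagonal value
  \<open>a\<close>, so its quadratic sum over a set depends only on the size of that set. The full
  set determines \<open>a\<close> in terms of \<open>quad_sum c V\<close>; substituting this value
  at size \<open>k\<close> gives the identity.\<close>

lemma sum_quad_sum_permutations:
  assumes "finite V" "card V = n" "n \<ge> 2" "K \<subseteq> V" "card K = k"
    and diag: "\<And>i. i \<in> V \<Longrightarrow> c i i = v"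
  shows "(\<Sum>p | p permutes V. quad_sum c (p ` K)) = card {p. p permutes V} *
    (balanced_bound n k v + real k * (real k - 1) / (real n * (real n - 1)) * quad_sum c V)"
proof -
  have pos: "real (card {p. p permutes V}) > 0"
    using card_permutations_pos[OF assms(1)] by simp
  obtain i0 j0 where ij: "i0 \<in> V" "j0 \<in> V" "i0 \<noteq> j0"
    using assms(2,3) by (metis card_le_Suc0_iff_eq assms(1) not_less_eq_eq numeral_2_eq_2)
  define a where "a = symmetrize V c i0 j0"
  have off: "symmetrize V c i j = a" if "i \<in> V" "j \<in> V" "i \<noteq> j" for i j
    unfolding a_def by (rule symmetrize_exchangeable) (use that ij in auto)
  have q: "quad_sum (symmetrize V c) L = real (card L) * v + real (card L) * (real (card L) - 1) * a"
    if "L \<subseteq> V" for L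
    using that finite_subset[OF that assms(1)]
    by (intro quad_sum_const off symmetrize_diag[OF assms(1) diag]) auto
  \<comment> \<open>Every permutation maps \<open>V\<close> onto itself, so all terms of the average
    coincide.\<close>
  have "quad_sum (symmetrize V c) V = quad_sum c V"
    using pos by (simp add: quad_sum_symmetrize permutes_image)
  then have "quad_sum c V = real n * v + real n * (real n - 1) * a"
    using q[of V] assms(2) by simp
  moreover define d where "d = real n - 1"
  ultimately have "quad_sum c V = real n * (v + d * a)" by (metis distrib_left mult.assoc)
  moreover have d: "real n = d + 1" "d > 0" and "real n > 0" using assms(3) by (auto simp: d_def)
  ultimately have "real k * (real k - 1) / (real n * d) * quad_sum c V =
      real k * (real k - 1) / d * (v + d * a)"
    by simp
  then have "real k * (real k - 1) / (real n * d) * quad_sum c V =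
      real k * (real k - 1) / d * v + real k * (real k - 1) * a"
    using d(2) by (simp add: distrib_left)
  moreover have "balanced_bound n k v = real k * v - real k * (real k - 1) / d * v"
    using d by (simp add: balanced_bound_def divide_simps) (simp add: algebra_simps)
  ultimately have "real k * v + real k * (real k - 1) * a =
      balanced_bound n k v + real k * (real k - 1) / (real n * (real n - 1)) * quad_sum c V"
    by (simp add: d_def)
  then have "quad_sum (symmetrize V c) K =
      balanced_bound n k v + real k * (real k - 1) / (real n * (real n - 1)) * quad_sum c V"
    using q[OF assms(4)] assms(5) by simp
  then show ?thesis
    using pos by (simp add: quad_sum_symmetrize field_simps)
qed

lemma permutes_image_card:
  assumes "p permutes V" "K \<subseteq> V"
  shows "p ` K \<subseteq> V" "card (p ` K) = card K"
  using assms permutes_image[OF assms(1)] card_image[OF permutes_inj_on[OF assms(1)]]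
  by auto

text \<open>Some set must reach the average over all permutations, and that average exceeds the
  bound by a nonnegative multiple of \<open>quad_sum c V\<close>.\<close>

lemma quad_sum_ge_balanced_bound:
  assumes "finite V" "card V = n" "n \<ge> 2" "1 \<le> k" "k \<le> n"
    and diag: "\<And>i. i \<in> V \<Longrightarrow> c i i = v" and nonneg: "quad_sum c V \<ge> 0"
  shows "\<exists>K\<subseteq>V. card K = k \<and> quad_sum c K \<ge> balanced_bound n k v"
proof (rule ccontr)
  assume "\<not> (\<exists>K\<subseteq>V. card K = k \<and> quad_sum c K \<ge> balanced_bound n k v)"
  then have less: "quad_sum c L < balanced_bound n k v" if "L \<subseteq> V" "card L = k" for L
    using that by force
  obtain K where K: "K \<subseteq> V" "card K = k"
    using assms(1,2,5) by (metis obtain_subset_with_card_n)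
  let ?P = "{p. p permutes V}"
  have "?P \<noteq> {}" "finite ?P"
    using card_permutations_pos[OF assms(1)] by (auto simp: card_gt_0_iff)
  moreover have "quad_sum c (p ` K) < balanced_bound n k v" if "p \<in> ?P" for p
    using less permutes_image_card[of p V K] K that by simp
  ultimately have "(\<Sum>p\<in>?P. quad_sum c (p ` K)) < (\<Sum>p\<in>?P. balanced_bound n k v)"
    by (intro sum_strict_mono) auto
  moreover have "real k * (real k - 1) / (real n * (real n - 1)) * quad_sum c V \<ge> 0"
    using assms(3,4) nonneg by (intro mult_nonneg_nonneg divide_nonneg_nonneg) auto
  then have "real (card ?P) * balanced_bound n k v \<le> real (card ?P) *
      (balanced_bound n k v + real k * (real k - 1) / (real n * (real n - 1)) * quad_sum c V)"
    by (intro mult_left_mono) auto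
  then have "real (card ?P) * balanced_bound n k v \<le> (\<Sum>p\<in>?P. quad_sum c (p ` K))"
    using sum_quad_sum_permutations[where c = c, OF assms(1-3) K diag] by simp
  ultimately show False by simp
qed

text \<open>The equality case of the averaging argument: if no set exceeds the bound, neither does
  the average, so the nonnegative excess vanishes and every term equals the bound.\<close>

lemma quad_sum_le_balanced_bound_imp:
  assumes "finite V" "card V = n" "n \<ge> 2" "2 \<le> k" "k \<le> n"
    and diag: "\<And>i. i \<in> V \<Longrightarrow> c i i = v" and nonneg: "quad_sum c V \<ge> 0"
    and le: "\<And>K. K \<subseteq> V \<Longrightarrow> card K = k \<Longrightarrow> quad_sum c K \<le> balanced_bound n k v"
  shows "quad_sum c V = 0"
    and "\<And>K. K \<subseteq> V \<Longrightarrow> card K = k \<Longrightarrow> quad_sum c K = balanced_bound n k v"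
proof -
  let ?P = "{p. p permutes V}"
  have pos: "card ?P > 0" and fin: "finite ?P"
    using card_permutations_pos[OF assms(1)] finite_permutations[OF assms(1)] by auto
  have le': "quad_sum c (p ` K) \<le> balanced_bound n k v"
    if "K \<subseteq> V" "card K = k" "p \<in> ?P" for K p
    using that permutes_image_card[of p V K] by (intro le) auto
  obtain K where K: "K \<subseteq> V" "card K = k"
    using assms(1,2,5) by (metis obtain_subset_with_card_n)
  have "(\<Sum>p\<in>?P. quad_sum c (p ` K)) \<le> (\<Sum>p\<in>?P. balanced_bound n k v)"
    by (intro sum_mono le'[OF K])
  then have "real (card ?P) *
      (balanced_bound n k v + real k * (real k - 1) / (real n * (real n - 1)) * quad_sum c V)
      \<le> real (card ?P) * balanced_bound n k v"
    using sum_quad_sum_permutations[where c = c, OF assms(1-3) K diag] by simp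
  then have "real k * (real k - 1) / (real n * (real n - 1)) * quad_sum c V \<le> 0"
    unfolding mult_le_cancel_left using pos by simp
  \<comment> \<open>This is where \<open>2 \<le> k\<close> enters: for \<open>k = 1\<close> the
    coefficient is zero and nothing about the full sum follows.\<close>
  moreover have "real k * (real k - 1) / (real n * (real n - 1)) > 0"
    using assms(3-5) by (intro divide_pos_pos mult_pos_pos) auto
  ultimately have "quad_sum c V \<le> 0"
    by (metis mult_le_cancel_left_pos mult_zero_right)
  then show zero: "quad_sum c V = 0"
    using nonneg by simp
  fix K assume K: "K \<subseteq> V" "card K = k"
  have "(\<Sum>p\<in>?P. quad_sum c (p ` K)) = (\<Sum>p\<in>?P. balanced_bound n k v)"
    using sum_quad_sum_permutations[where c = c, OF assms(1-3) K diag] by (simp add: zero)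
  \<comment> \<open>Two equal sums with termwise inequality agree term by term; the term of the
    identity permutation concerns \<open>K\<close> itself.\<close>
  then have "quad_sum c (id ` K) = balanced_bound n k v"
    by (rule sum_mono_inv[where i = id]) (use le'[OF K] permutes_id fin in auto)
  then show "quad_sum c K = balanced_bound n k v" by simp
qed

section \<open>Recovering the entries from constant quadratic sums\<close>

lemma quad_sum_insert:
  assumes "finite L" "i \<notin> L" "\<And>a b. c a b = c b a"
  shows "quad_sum c (insert i L) = quad_sum c L + 2 * (\<Sum>l\<in>L. c i l) + c i i"
proof -
  have "(\<Sum>l\<in>L. c l i) = (\<Sum>l\<in>L. c i l)"
    using assms(3) by (intro sum.cong) auto
  then show ?thesis
    using assms(1,2) by (simp add: quad_sum_def sum.distrib)
qed

text \<open>Exchanging one element of an \<open>m\<close>-set for an outside point \<open>x\<close>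
  keeps the sum at zero, so \<open>d\<close> is constant on the set together with \<open>x\<close>.
  The singleton case is separate because \<open>W\<close> may then have no further point to
  exchange.\<close>

lemma zero_if_sum_subsets_zero:
  fixes d :: "'b \<Rightarrow> real"
  assumes "finite W" "1 \<le> m" "m < card W \<or> m = 1"
    and zero: "\<And>L. L \<subseteq> W \<Longrightarrow> card L = m \<Longrightarrow> sum d L = 0"
    and "x \<in> W"
  shows "d x = 0"
proof (cases "m = 1")
  case True
  then show ?thesis using zero[of "{x}"] assms(5) by simp
next
  case False
  then have m: "m < card W" using assms(3) by simp
  have "card (W - {x}) = card W - 1" using assms(1,5) by simp
  then obtain L where L: "L \<subseteq> W - {x}" "card L = m"
    using m by (metis Suc_leI Suc_pred' le_less_trans less_Suc_eq_le obtain_subset_with_card_n zero_le)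
  have fin: "finite L" using L assms(1) by (meson finite_Diff finite_subset)
  have eq: "d y = d x" if y: "y \<in> L" for y
  proof -
    have "sum d (insert x (L - {y})) = 0"
      using L y assms(5) fin card_Suc_Diff1[OF fin y] by (intro zero) (auto simp: card_insert_if)
    moreover have "sum d L = 0" using L by (intro zero) auto
    moreover have "sum d (insert x (L - {y})) = d x + sum d (L - {y})"
      using L fin by (intro sum.insert) auto
    moreover have "sum d L = d y + sum d (L - {y})"
      using fin y by (rule sum.remove)
    ultimately show ?thesis by simp
  qed
  have "sum d L = 0" using L by (intro zero) auto
  moreover have "sum d L = real m * d x" using eq L(2) by simp
  ultimately show ?thesis using assms(2) by simp
qed

text \<open>Comparing \<open>insert x L\<close> with \<open>insert y L\<close> cancels everything
  but the cross terms, so \<open>c x l - c y l\<close> sums to zero over every \<open>L\<close> of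
  size \<open>k - 1\<close> avoiding \<open>x\<close> and \<open>y\<close>. The size condition
  excludes \<open>k = n - 1\<close> for \<open>n > 3\<close>: if a vector sums to zero, the sum of
  all entries but one is minus the remaining entry, which says nothing about covariances.\<close>

lemma off_diagonal_if_quad_sum_const:
  assumes "finite V" "card V = n" "n \<ge> 3" "2 \<le> k" "k < n" "k + 2 \<le> n \<or> k = 2"
    and sym: "\<And>i j. c i j = c j i" and diag: "\<And>i. i \<in> V \<Longrightarrow> c i i = v"
    and zero: "quad_sum c V = 0"
    and const: "\<And>K. K \<subseteq> V \<Longrightarrow> card K = k \<Longrightarrow> quad_sum c K = b"
    and "i \<in> V" "j \<in> V" "i \<noteq> j"
  shows "c i j = - v / (real n - 1)"
proof -
  have eq: "c x l = c y l" if "x \<in> V" "y \<in> V" "l \<in> V" "x \<noteq> y" "l \<noteq> x" "l \<noteq> y" for x y l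
  proof -
    have card: "card (V - {x, y}) = n - 2"
      using that assms(1,2) by (simp add: card_Diff_subset)
    have "(\<Sum>l\<in>L. c x l - c y l) = 0" if L: "L \<subseteq> V - {x, y}" "card L = k - 1" for L
    proof -
      have fin: "finite L" using L assms(1) by (meson finite_Diff finite_subset)
      have "quad_sum c (insert x L) = b" "quad_sum c (insert y L) = b"
        using L fin \<open>x \<in> V\<close> \<open>y \<in> V\<close> assms(4) by (auto intro!: const simp: card_insert_if)
      moreover have "x \<notin> L" "y \<notin> L" using L by auto
      ultimately show ?thesis
        using quad_sum_insert[where c = c, OF fin _ sym] diag \<open>x \<in> V\<close> \<open>y \<in> V\<close>
        by (simp add: sum_subtractf)
    qed
    then have "c x l - c y l = 0"
      by (rule zero_if_sum_subsets_zero[where m = "k - 1" and W = "V - {x, y}", rotated 3])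
        (use that assms(1,4,6) card in auto)
    then show ?thesis by simp
  qed
  \<comment> \<open>Change the row, then use symmetry to change the column. If \<open>y = i\<close>,
    passing through \<open>c i y\<close> would hit the diagonal, so the route goes through
    \<open>c j i\<close> instead.\<close>
  have off: "c x y = c i j" if "x \<in> V" "y \<in> V" "x \<noteq> y" for x y
  proof (cases "y = i")
    case False
    have "c x y = c i y"
      using eq[of x i y] that False assms(11) by (cases "x = i") auto
    also have "\<dots> = c i j"
      using eq[of y j i] sym that False assms(11-13) by (cases "y = j") auto
    finally show ?thesis .
  next
    case True
    then show ?thesis
      using eq[of x j i] sym[of i j] that assms(11-13) by (cases "x = j") auto
  qed
  have "real n * v + real n * (real n - 1) * c i j = 0"
    using quad_sum_const[where c = c, OF assms(1) diag off] zero assms(2) by simp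
  then have "real n * (v + (real n - 1) * c i j) = 0" by (simp add: algebra_simps)
  then have "v + (real n - 1) * c i j = 0" using assms(3) by simp
  then show ?thesis using assms(3) by (simp add: field_simps)
qed

section \<open>Second moments and the randomly permuted joint mix\<close>

text \<open>Uncentred, so that it matches the objective directly; under mean zero it is the
  covariance, see \<open>covariance_eq\<close>.\<close>

definition mixed_moment :: "'a measure \<Rightarrow> (nat \<Rightarrow> 'a \<Rightarrow> real) \<Rightarrow> nat \<Rightarrow> nat \<Rightarrow> real" where
  "mixed_moment M X i j = (\<integral>\<omega>. X i \<omega> * X j \<omega> \<partial>M)"

lemma mixed_moment_commute: "mixed_moment M X i j = mixed_moment M X j i"
  by (simp add: mixed_moment_def mult.commute)

text \<open>The facts below are applied to the given vector, to arbitrary competitors and to the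
  randomly permuted vector alike.\<close>

locale square_integrable_marginals =
  fixes n :: nat and F :: "real measure" and M :: "'a measure" and X :: "nat \<Rightarrow> 'a \<Rightarrow> real"
  assumes marginals: "has_marginals n F M X"
    and square_integrable: "integrable F (\<lambda>x. x\<^sup>2)"
begin

lemma prob_space: "prob_space M"
  and measurable: "i \<in> {1..n} \<Longrightarrow> X i \<in> borel_measurable M"
  and distr: "i \<in> {1..n} \<Longrightarrow> distr M borel (X i) = F"
  using marginals by (auto simp: has_marginals_def)

lemma integral_marginal:
  assumes "i \<in> {1..n}" and [measurable]: "f \<in> borel_measurable borel"
  shows "(\<integral>\<omega>. f (X i \<omega>) \<partial>M) = (\<integral>x. f x \<partial>F :: real)"
  using integral_distr[OF measurable[OF assms(1)] assms(2)] distr[OF assms(1)] by simp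

lemma mixed_moment_diag: "i \<in> {1..n} \<Longrightarrow> mixed_moment M X i i = (\<integral>x. x\<^sup>2 \<partial>F)"
  using integral_marginal[of i "\<lambda>x. x\<^sup>2"] by (simp add: mixed_moment_def power2_eq_square)

text \<open>The product is dominated by the sum of the two squares, each integrable because its
  marginal is \<open>F\<close>.\<close>

lemma integrable_mult:
  assumes "i \<in> {1..n}" "j \<in> {1..n}"
  shows "integrable M (\<lambda>\<omega>. X i \<omega> * X j \<omega>)"
proof (rule Bochner_Integration.integrable_bound)
  have "integrable M (\<lambda>\<omega>. (X l \<omega>)\<^sup>2)" if "l \<in> {1..n}" for l
    using square_integrable distr[OF that] integrable_distr_eq[OF measurable[OF that], of "\<lambda>x. x\<^sup>2"]
    by simp
  then show "integrable M (\<lambda>\<omega>. (X i \<omega>)\<^sup>2 + (X j \<omega>)\<^sup>2)"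
    using assms by (intro Bochner_Integration.integrable_add)
  show "(\<lambda>\<omega>. X i \<omega> * X j \<omega>) \<in> borel_measurable M"
    using assms by (intro borel_measurable_times measurable)
  have "\<bar>x * y\<bar> \<le> x\<^sup>2 + y\<^sup>2" for x y :: real
  proof -
    have "2 * \<bar>x\<bar> * \<bar>y\<bar> \<le> x\<^sup>2 + y\<^sup>2" using sum_squares_bound[of "\<bar>x\<bar>" "\<bar>y\<bar>"] by simp
    moreover have "\<bar>x\<bar> * \<bar>y\<bar> \<ge> 0" by simp
    ultimately show ?thesis unfolding abs_mult by linarith
  qed
  then show "AE \<omega> in M. norm (X i \<omega> * X j \<omega>) \<le> norm ((X i \<omega>)\<^sup>2 + (X j \<omega>)\<^sup>2)"
    by (intro AE_I2) simp
qed

lemma square_sum_eq: "(\<Sum>i\<in>K. X i \<omega>)\<^sup>2 = (\<Sum>i\<in>K. \<Sum>j\<in>K. X i \<omega> * X j \<omega>)"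
  by (simp add: power2_eq_square sum_product)

lemma integrable_square_sum:
  assumes "K \<subseteq> {1..n}"
  shows "integrable M (\<lambda>\<omega>. (\<Sum>i\<in>K. X i \<omega>)\<^sup>2)"
  unfolding square_sum_eq using assms
  by (intro Bochner_Integration.integrable_sum integrable_mult) auto

lemma integral_square_sum:
  assumes "K \<subseteq> {1..n}"
  shows "(\<integral>\<omega>. (\<Sum>i\<in>K. X i \<omega>)\<^sup>2 \<partial>M) = quad_sum (mixed_moment M X) K"
proof -
  have int: "integrable M (\<lambda>\<omega>. X i \<omega> * X j \<omega>)" if "i \<in> K" "j \<in> K" for i j
    using that assms by (intro integrable_mult) auto
  have "(\<integral>\<omega>. (\<Sum>i\<in>K. X i \<omega>)\<^sup>2 \<partial>M) = (\<Sum>i\<in>K. \<integral>\<omega>. (\<Sum>j\<in>K. X i \<omega> * X j \<omega>) \<partial>M)"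
    unfolding square_sum_eq
    by (intro Bochner_Integration.integral_sum Bochner_Integration.integrable_sum int)
  also have "\<dots> = (\<Sum>i\<in>K. \<Sum>j\<in>K. \<integral>\<omega>. X i \<omega> * X j \<omega> \<partial>M)"
    by (intro sum.cong refl Bochner_Integration.integral_sum int)
  finally show ?thesis by (simp add: quad_sum_def mixed_moment_def)
qed

lemma quad_sum_nonneg: "K \<subseteq> {1..n} \<Longrightarrow> quad_sum (mixed_moment M X) K \<ge> 0"
  by (simp flip: integral_square_sum)

lemma quad_sum_eq_0_iff:
  "quad_sum (mixed_moment M X) {1..n} = 0 \<longleftrightarrow> (AE \<omega> in M. (\<Sum>i\<in>{1..n}. X i \<omega>) = 0)"
  using integral_nonneg_eq_0_iff_AE[OF integrable_square_sum[OF subset_refl]]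
  by (simp add: integral_square_sum)

lemma max_sq_sum_eq:
  assumes "\<K> \<subseteq> Pow {1..n}"
  shows "max_sq_sum \<K> M X = Max (quad_sum (mixed_moment M X) ` \<K>)"
  unfolding max_sq_sum_def using assms
  by (intro arg_cong[where f = Max] image_cong refl integral_square_sum) blast

lemma covariance_eq:
  assumes "(\<integral>x. x \<partial>F) = 0" "i \<in> {1..n}" "j \<in> {1..n}"
  shows "covariance M (X i) (X j) = mixed_moment M X i j"
  using assms integral_marginal[of _ "\<lambda>x. x"] by (simp add: covariance_def mixed_moment_def)

text \<open>The constant in a joint mix is the expectation of the sum, hence zero.\<close>

lemma joint_mix_iff:
  assumes "integrable F (\<lambda>x. x)" "(\<integral>x. x \<partial>F) = 0"
  shows "joint_mix n M X \<longleftrightarrow> quad_sum (mixed_moment M X) {1..n} = 0"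
proof
  assume "joint_mix n M X"
  then obtain c where c: "AE \<omega> in M. (\<Sum>i\<in>{1..n}. X i \<omega>) = c"
    by (auto simp: joint_mix_def)
  have int: "integrable M (X i)" if "i \<in> {1..n}" for i
    using integrable_distr[OF measurable[OF that], of "\<lambda>x. x"] assms(1) distr[OF that] by metis
  have "(\<integral>\<omega>. (\<Sum>i\<in>{1..n}. X i \<omega>) \<partial>M) = (\<integral>\<omega>. c \<partial>M)"
    using c measurable by (intro integral_cong_AE) auto
  moreover have "(\<integral>\<omega>. (\<Sum>i\<in>{1..n}. X i \<omega>) \<partial>M) = (\<Sum>i\<in>{1..n}. \<integral>\<omega>. X i \<omega> \<partial>M)"
    by (intro Bochner_Integration.integral_sum int)
  moreover have "\<dots> = 0"
    using assms(2) integral_marginal[of _ "\<lambda>x. x"] by simp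
  ultimately have "c = 0"
    using prob_space.prob_space[OF prob_space] by simp
  then show "quad_sum (mixed_moment M X) {1..n} = 0"
    using c unfolding quad_sum_eq_0_iff by simp
next
  assume "quad_sum (mixed_moment M X) {1..n} = 0"
  then show "joint_mix n M X"
    unfolding quad_sum_eq_0_iff joint_mix_def by blast
qed

end

section \<open>The vector with independently and uniformly permuted indices\<close>

definition permuted_space :: "nat \<Rightarrow> 'a measure \<Rightarrow> ((nat \<Rightarrow> nat) \<times> 'a) measure" where
  "permuted_space n M = uniform_count_measure {p. p permutes {1..n}} \<Otimes>\<^sub>M M"

definition permuted_vector ::
  "(nat \<Rightarrow> 'a \<Rightarrow> real) \<Rightarrow> nat \<Rightarrow> (nat \<Rightarrow> nat) \<times> 'a \<Rightarrow> real" where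
  "permuted_vector X i = (\<lambda>(p, \<omega>). X (p i) \<omega>)"

text \<open>Given the permutation \<open>p\<close>, the coordinate \<open>i\<close> is
  \<open>X (p i)\<close>, whose law is \<open>F\<close> whatever \<open>p\<close> is; averaging over
  \<open>p\<close> leaves \<open>F\<close>.\<close>

lemma (in square_integrable_marginals) has_marginals_permuted:
  "has_marginals n F (permuted_space n M) (permuted_vector X)"
proof -
  let ?P = "{p. p permutes {1..n}}"
  let ?U = "uniform_count_measure ?P"
  have fin: "finite ?P" and ne: "?P \<noteq> {}"
    using card_permutations_pos[of "{1..n}"] by (auto simp: card_gt_0_iff)
  interpret U: prob_space ?U
    using fin ne by (rule prob_space_uniform_count_measure)
  interpret M: prob_space M by (rule prob_space)
  interpret pair_prob_space ?U M ..
  show ?thesis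
    unfolding has_marginals_def
  proof (intro conjI ballI)
    show "prob_space (permuted_space n M)"
      unfolding permuted_space_def by (rule prob_space_axioms)
    fix i assume i: "i \<in> {1..n}"
    have pi: "p i \<in> {1..n}" if "p \<in> ?P" for p
      using that i permutes_in_image[of p] by blast
    \<comment> \<open>The first factor is countable, so measurability may be checked for each fixed
      \<open>p\<close>.\<close>
    have "permuted_vector X i \<in> borel_measurable (count_space ?P \<Otimes>\<^sub>M M)"
      using fin pi measurable
      by (intro measurable_pair_measure_countable1) (auto simp: permuted_vector_def countable_finite)
    then show meas: "permuted_vector X i \<in> borel_measurable (permuted_space n M)"
      unfolding permuted_space_def
      by (simp cong: measurable_cong_sets add: sets_uniform_count_measure_count_space
          cong: sets_pair_measure_cong)
    show "distr (permuted_space n M) borel (permuted_vector X i) = F"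
    proof (rule measure_eqI)
      show "sets (distr (permuted_space n M) borel (permuted_vector X i)) = sets F"
        using distr[OF i] by (metis sets_distr)
      fix A assume "A \<in> sets (distr (permuted_space n M) borel (permuted_vector X i))"
      then have A: "A \<in> sets borel" by simp
      have slice: "emeasure M (Pair p -` (permuted_vector X i -` A \<inter> space (?U \<Otimes>\<^sub>M M))) = emeasure F A"
        if "p \<in> ?P" for p
      proof -
        have "Pair p -` (permuted_vector X i -` A \<inter> space (?U \<Otimes>\<^sub>M M)) = X (p i) -` A \<inter> space M"
          using that by (auto simp: permuted_vector_def space_pair_measure space_uniform_count_measure)
        then show ?thesis
          using emeasure_distr[OF measurable[OF pi[OF that]] A] distr[OF pi[OF that]] by simp
      qed
      have "emeasure (distr (permuted_space n M) borel (permuted_vector X i)) A =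
          emeasure (?U \<Otimes>\<^sub>M M) (permuted_vector X i -` A \<inter> space (?U \<Otimes>\<^sub>M M))"
        using emeasure_distr[OF meas A] by (simp add: permuted_space_def)
      also have "\<dots> = (\<integral>\<^sup>+p. emeasure M (Pair p -` (permuted_vector X i -` A \<inter> space (?U \<Otimes>\<^sub>M M))) \<partial>?U)"
        using measurable_sets[OF meas A]
        by (intro M.emeasure_pair_measure_alt) (simp add: permuted_space_def)
      also have "\<dots> = (\<integral>\<^sup>+p. emeasure F A \<partial>?U)"
        using slice by (intro nn_integral_cong) (simp add: space_uniform_count_measure)
      also have "\<dots> = emeasure F A"
        using U.emeasure_space_1 by (simp only: nn_integral_const mult_1_right)
      finally show "emeasure (distr (permuted_space n M) borel (permuted_vector X i)) A = emeasure F A" .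
    qed
  qed
qed

text \<open>Fubini: integrate over \<open>M\<close> first, then average over the finitely many
  permutations.\<close>

lemma (in square_integrable_marginals) mixed_moment_permuted:
  assumes "i \<in> {1..n}" "j \<in> {1..n}"
  shows "mixed_moment (permuted_space n M) (permuted_vector X) i j =
    symmetrize {1..n} (mixed_moment M X) i j"
proof -
  let ?P = "{p. p permutes {1..n}}"
  let ?U = "uniform_count_measure ?P"
  have fin: "finite ?P" and ne: "?P \<noteq> {}"
    using card_permutations_pos[of "{1..n}"] by (auto simp: card_gt_0_iff)
  interpret U: prob_space ?U
    using fin ne by (rule prob_space_uniform_count_measure)
  interpret M: prob_space M by (rule prob_space)
  interpret pair_prob_space ?U M ..
  \<comment> \<open>The permuted vector has marginals \<open>F\<close> too, which supplies the
    integrability on the product space that Fubini requires.\<close>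
  interpret Z: square_integrable_marginals n F "permuted_space n M" "permuted_vector X"
    by unfold_locales (rule has_marginals_permuted square_integrable)+
  have eq: "(\<lambda>x. permuted_vector X i x * permuted_vector X j x) =
      (\<lambda>(p, \<omega>). X (p i) \<omega> * X (p j) \<omega>)"
    by (auto simp: permuted_vector_def)
  have "integrable (?U \<Otimes>\<^sub>M M) (\<lambda>(p, \<omega>). X (p i) \<omega> * X (p j) \<omega>)"
    using Z.integrable_mult[OF assms] unfolding eq by (simp add: permuted_space_def)
  from integral_fst[OF this, symmetric] show ?thesis
    unfolding mixed_moment_def eq symmetrize_def permuted_space_def
    by (simp only: integral_uniform_count_measure[OF fin])
qed

section \<open>Minimizers\<close>

lemma balanced_bound_mono:
  assumes "k * (n - k) \<le> l * (n - l)" "k \<le> n" "l \<le> n" "n \<ge> 2" "v \<ge> 0"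
  shows "balanced_bound n k v \<le> balanced_bound n l v"
proof -
  have "real k * (real n - real k) \<le> real l * (real n - real l)"
    using assms(1-3) by (metis of_nat_diff of_nat_le_iff of_nat_mult)
  then show ?thesis
    unfolding balanced_bound_def using assms(4,5)
    by (intro mult_right_mono divide_right_mono) auto
qed

text \<open>With \<open>m = n div 2\<close> the right side minus the left is
  \<open>(k - m)^2\<close> for even \<open>n\<close> and \<open>(k - m) * (k - m - 1)\<close> for
  odd \<open>n\<close>, a product of consecutive integers.\<close>

lemma mult_diff_le_balanced:
  fixes k n :: nat
  assumes "k \<le> n"
  shows "k * (n - k) \<le> (n - n div 2) * (n - (n - n div 2))"
proof -
  define m where "m = n div 2"
  have n: "n = 2 * m \<or> n = 2 * m + 1" and "n - (n - n div 2) = m"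
    by (auto simp: m_def)
  have sq: "(int k - int m) * (int k - int m) \<ge> 0"
    and sq': "(int k - int m) * (int k - int m - 1) \<ge> 0"
    by (auto simp: zero_le_mult_iff)
  have le: "int k * (int n - int k) \<le> (int n - int m) * int m"
    using n
  proof
    assume "n = 2 * m"
    then show ?thesis using sq by (simp add: algebra_simps)
  next
    assume "n = 2 * m + 1"
    then show ?thesis using sq' by (simp add: algebra_simps)
  qed
  have "m \<le> n" by (simp add: m_def)
  then have "int (k * (n - k)) \<le> int ((n - m) * m)"
    using assms le by (simp only: of_nat_mult of_nat_diff)
  then have "k * (n - k) \<le> (n - m) * m" by (simp only: of_nat_le_iff)
  then show ?thesis
    using \<open>n - (n - n div 2) = m\<close> by (simp add: m_def)
qed

text \<open>Covers both problems at once: the family must contain all sets of size \<open>k\<close>,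
  and no member may have a larger \<open>balanced_bound\<close> than those.\<close>

lemma (in square_integrable_marginals) minimizer_iff_mixed_moment:
  assumes n: "n \<ge> 3" and mixable: "completely_mixable n F"
    and mean: "integrable F (\<lambda>x. x)" "(\<integral>x. x \<partial>F) = 0"
    and k: "2 \<le> k" "k < n" "k + 2 \<le> n \<or> k = 2"
    and sub: "\<K> \<subseteq> Pow {1..n}"
    and super: "{K. K \<subseteq> {1..n} \<and> card K = k} \<subseteq> \<K>"
    and balanced: "\<And>K. K \<in> \<K> \<Longrightarrow> card K * (n - card K) \<le> k * (n - k)"
  shows "minimizer n F \<K> M X \<longleftrightarrow>
    (\<forall>i\<in>{1..n}. \<forall>j\<in>{1..n}. i \<noteq> j \<longrightarrow> mixed_moment M X i j = - (\<integral>x. x\<^sup>2 \<partial>F) / (real n - 1))"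
    (is "_ \<longleftrightarrow> (\<forall>i\<in>_. \<forall>j\<in>_. _ \<longrightarrow> _ = - ?v / _)")
proof -
  have card: "card {1..n} = n" by simp
  have fin: "finite \<K>" using sub by (rule finite_subset) simp
  have v: "?v \<ge> 0" by simp
  \<comment> \<open>The sample type stays free because this is used both for the permuted mix and
    for \<open>X\<close>.\<close>
  have optimal: "max_sq_sum \<K> N Y \<le> balanced_bound n k ?v"
    if "has_marginals n F N Y"
      and off: "\<And>i j. i \<in> {1..n} \<Longrightarrow> j \<in> {1..n} \<Longrightarrow> i \<noteq> j \<Longrightarrow>
        mixed_moment N Y i j = - ?v / (real n - 1)"
    for N :: "'c measure" and Y
  proof -
    interpret Y: square_integrable_marginals n F N Y
      by unfold_locales (rule that square_integrable)+
    have "quad_sum (mixed_moment N Y) K \<le> balanced_bound n k ?v" if K: "K \<in> \<K>" for K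
    proof -
      have K': "K \<subseteq> {1..n}" using K sub by auto
      then have "finite K" by (rule finite_subset) simp
      then have "quad_sum (mixed_moment N Y) K = balanced_bound n (card K) ?v"
        using K' n by (intro quad_sum_eq_balanced_bound off Y.mixed_moment_diag) auto
      also have "\<dots> \<le> balanced_bound n k ?v"
        using balanced[OF K] card_mono[OF _ K'] k n v by (intro balanced_bound_mono) auto
      finally show ?thesis .
    qed
    moreover have "\<K> \<noteq> {}"
    proof -
      have "{1..k} \<in> \<K>" using super k by auto
      then show ?thesis by auto
    qed
    ultimately show ?thesis
      using fin by (simp add: Y.max_sq_sum_eq[OF sub])
  qed
  have lower: "balanced_bound n k ?v \<le> max_sq_sum \<K> N Y"
    if "has_marginals n F N Y" for N :: "(nat \<Rightarrow> real) measure" and Y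
  proof -
    interpret Y: square_integrable_marginals n F N Y
      by unfold_locales (rule that square_integrable)+
    have "\<exists>K\<subseteq>{1..n}. card K = k \<and> quad_sum (mixed_moment N Y) K \<ge> balanced_bound n k ?v"
    proof (rule quad_sum_ge_balanced_bound)
      show "quad_sum (mixed_moment N Y) {1..n} \<ge> 0" by (rule Y.quad_sum_nonneg) simp
      show "2 \<le> n" "1 \<le> k" "k \<le> n" using n k by auto
      show "mixed_moment N Y i i = ?v" if "i \<in> {1..n}" for i
        using that by (rule Y.mixed_moment_diag)
    qed auto
    then obtain K where K: "K \<subseteq> {1..n}" "card K = k"
      "quad_sum (mixed_moment N Y) K \<ge> balanced_bound n k ?v"
      by blast
    then have "K \<in> \<K>" using super by auto
    then have "quad_sum (mixed_moment N Y) K \<le> max_sq_sum \<K> N Y"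
      using fin by (simp add: Y.max_sq_sum_eq[OF sub])
    then show ?thesis using K(3) by simp
  qed
  show ?thesis
  proof (intro iffI ballI impI)
    assume min: "minimizer n F \<K> M X"
    obtain N :: "(nat \<Rightarrow> real) measure" and Y
      where N: "has_marginals n F N Y" "joint_mix n N Y"
      using mixable by (auto simp: completely_mixable_def)
    interpret Y: square_integrable_marginals n F N Y
      by unfold_locales (rule N square_integrable)+
    \<comment> \<open>The joint mix \<open>Y\<close> may have unequal covariances. Permuting makes
      them equal and keeps the second moment of the full sum at zero, which fixes their common
      value.\<close>
    have off: "mixed_moment (permuted_space n N) (permuted_vector Y) i j = - ?v / (real n - 1)"
      if ij: "i \<in> {1..n}" "j \<in> {1..n}" "i \<noteq> j" for i j
    proof -
      let ?s = "symmetrize {1..n} (mixed_moment N Y)"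
      have "quad_sum ?s {1..n} = quad_sum (mixed_moment N Y) {1..n}"
        using card_permutations_pos[of "{1..n}"] by (simp add: quad_sum_symmetrize permutes_image)
      also have "\<dots> = 0"
        using N(2) Y.joint_mix_iff[OF mean] by simp
      finally have zero: "quad_sum ?s {1..n} = 0" .
      have "quad_sum ?s {1..n} =
          real (card {1..n}) * ?v + real (card {1..n}) * (real (card {1..n}) - 1) * ?s i j"
        by (intro quad_sum_const symmetrize_exchangeable symmetrize_diag Y.mixed_moment_diag ij) auto
      then have "real n * (?v + (real n - 1) * ?s i j) = 0"
        using zero by (simp add: algebra_simps)
      then have "?v + (real n - 1) * ?s i j = 0" using n by simp
      then show ?thesis
        using n unfolding Y.mixed_moment_permuted[OF ij(1,2)] by (simp add: field_simps)
    qed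
    have "max_sq_sum \<K> M X \<le> max_sq_sum \<K> (permuted_space n N) (permuted_vector Y)"
      by (rule minimizer_le[OF min sub Y.has_marginals_permuted])
    also have "\<dots> \<le> balanced_bound n k ?v"
      using Y.has_marginals_permuted off by (rule optimal)
    finally have max_le: "Max (quad_sum (mixed_moment M X) ` \<K>) \<le> balanced_bound n k ?v"
      by (simp add: max_sq_sum_eq[OF sub])
    have le: "quad_sum (mixed_moment M X) K \<le> balanced_bound n k ?v"
      if "K \<subseteq> {1..n}" "card K = k" for K
    proof (rule order_trans[OF Max_ge max_le])
      show "quad_sum (mixed_moment M X) K \<in> quad_sum (mixed_moment M X) ` \<K>"
        using that super by auto
    qed (use fin in simp)
    have nonneg: "quad_sum (mixed_moment M X) {1..n} \<ge> 0" by (rule quad_sum_nonneg) simp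
    have "n \<ge> 2" "k \<le> n" using n k by auto
    \<comment> \<open>Comparison with the permuted mix shows that no \<open>k\<close>-set of
      \<open>X\<close> exceeds the bound, so the equality case applies to \<open>X\<close>.\<close>
    note tight = quad_sum_le_balanced_bound_imp[where c = "mixed_moment M X" and v = ?v,
        OF finite_atLeastAtMost card this(1) k(1) this(2) mixed_moment_diag nonneg le]
    fix i j assume ij: "i \<in> {1..n}" "j \<in> {1..n}" "i \<noteq> j"
    show "mixed_moment M X i j = - ?v / (real n - 1)"
    proof (rule off_diagonal_if_quad_sum_const[where c = "mixed_moment M X" and v = ?v,
          OF finite_atLeastAtMost card n k])
      show "mixed_moment M X a b = mixed_moment M X b a" for a b
        by (rule mixed_moment_commute)
    qed (rule mixed_moment_diag tight ij; assumption)+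
  next
    assume "\<forall>i\<in>{1..n}. \<forall>j\<in>{1..n}. i \<noteq> j \<longrightarrow> mixed_moment M X i j = - ?v / (real n - 1)"
    then have "max_sq_sum \<K> M X \<le> balanced_bound n k ?v"
      using marginals by (intro optimal) auto
    then show "minimizer n F \<K> M X"
      using lower marginals order_trans unfolding minimizer_def by blast
  qed
qed

text \<open>All variances equal the second moment of \<open>F\<close>, so the correlations are the
  mixed moments divided by it. The prescribed off-diagonal value is negative, giving NCD, and makes
  the full sum vanish.\<close>

lemma (in square_integrable_marginals) P_star_iff_mixed_moment:
  assumes n: "n \<ge> 2" and mean: "integrable F (\<lambda>x. x)" "(\<integral>x. x \<partial>F) = 0"
    and pos: "(\<integral>x. x\<^sup>2 \<partial>F) > 0"
  shows "NCD n M X \<and> joint_mix n M X \<and> has_correlation_matrix n M X (P_star n) \<longleftrightarrow>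
    (\<forall>i\<in>{1..n}. \<forall>j\<in>{1..n}. i \<noteq> j \<longrightarrow> mixed_moment M X i j = - (\<integral>x. x\<^sup>2 \<partial>F) / (real n - 1))"
    (is "_ \<longleftrightarrow> (\<forall>i\<in>_. \<forall>j\<in>_. _ \<longrightarrow> _ = - ?v / _)")
proof -
  have corr: "correlation M (X i) (X j) = mixed_moment M X i j / ?v"
    if "i \<in> {1..n}" "j \<in> {1..n}" for i j
    using that pos by (simp add: correlation_def covariance_eq[OF mean(2)] mixed_moment_diag)
  show ?thesis
  proof
    assume "NCD n M X \<and> joint_mix n M X \<and> has_correlation_matrix n M X (P_star n)"
    then have "mixed_moment M X i j / ?v = - 1 / (real n - 1)"
      if "i \<in> {1..n}" "j \<in> {1..n}" "i \<noteq> j" for i j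
      using that corr[of i j] by (simp add: has_correlation_matrix_def P_star_def)
    then show "\<forall>i\<in>{1..n}. \<forall>j\<in>{1..n}. i \<noteq> j \<longrightarrow> mixed_moment M X i j = - ?v / (real n - 1)"
      using pos by (simp add: field_simps)
  next
    assume off: "\<forall>i\<in>{1..n}. \<forall>j\<in>{1..n}. i \<noteq> j \<longrightarrow> mixed_moment M X i j = - ?v / (real n - 1)"
    have "NCD n M X"
      unfolding NCD_def using off n pos by (auto simp: covariance_eq[OF mean(2)])
    \<comment> \<open>\<open>balanced_bound\<close> contains the factor \<open>n - k\<close>, which
      is zero for the full set.\<close>
    moreover have "quad_sum (mixed_moment M X) {1..n} = balanced_bound n (card {1..n}) ?v"
      using off n by (intro quad_sum_eq_balanced_bound mixed_moment_diag) auto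
    then have "joint_mix n M X"
      unfolding joint_mix_iff[OF mean] by (simp add: balanced_bound_def)
    moreover have "has_correlation_matrix n M X (P_star n)"
      unfolding has_correlation_matrix_def P_star_def
      using off pos by (auto simp: corr mixed_moment_diag)
    ultimately show "NCD n M X \<and> joint_mix n M X \<and> has_correlation_matrix n M X (P_star n)"
      by blast
  qed
qed

theorem theorem5:
  fixes n :: nat and F :: "real measure"
    and M :: "'a measure" and X :: "nat \<Rightarrow> 'a \<Rightarrow> real"
  assumes "n \<ge> 3"
    and "real_distribution F"
    and "completely_mixable n F"
    and "integrable F (\<lambda>x. x)" and "(\<integral>x. x \<partial>F) = 0"
    and "integrable F (\<lambda>x. x\<^sup>2)" and "prob_space.variance F (\<lambda>x. x) > 0"
    and "has_marginals n F M X"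
  shows "(minimizer n F (Pow {1..n}) M X \<longleftrightarrow>
            NCD n M X \<and> joint_mix n M X \<and> has_correlation_matrix n M X (P_star n)) \<and>
         (\<forall>k \<in> {1..n} - {1, n - 1, n}.
            minimizer n F {K. K \<subseteq> {1..n} \<and> card K = k} M X \<longleftrightarrow>
            NCD n M X \<and> joint_mix n M X \<and> has_correlation_matrix n M X (P_star n))"
proof -
  interpret square_integrable_marginals n F M X
    by unfold_locales (rule assms)+
  have pos: "(\<integral>x. x\<^sup>2 \<partial>F) > 0"
    using assms(5,7) by simp
  have n: "n \<ge> 2" using assms(1) by simp
  note star = P_star_iff_mixed_moment[OF n assms(4,5) pos]
  note moments = minimizer_iff_mixed_moment[OF assms(1,3-5)]
  have "minimizer n F (Pow {1..n}) M X \<longleftrightarrow>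
      NCD n M X \<and> joint_mix n M X \<and> has_correlation_matrix n M X (P_star n)"
    unfolding star
  proof (rule moments)
    \<comment> \<open>Rounding up matters: for \<open>n = 3\<close> it gives 2, whereas
      \<open>n div 2\<close> would be 1 and violate \<open>2 \<le> k\<close>.\<close>
    let ?k = "n - n div 2"
    show "2 \<le> ?k" "?k < n" "?k + 2 \<le> n \<or> ?k = 2" using assms(1) by presburger+
    fix K assume "K \<in> Pow {1..n}"
    then have "card K \<le> n" using card_mono[of "{1..n}" K] by simp
    then show "card K * (n - card K) \<le> (n - n div 2) * (n - (n - n div 2))"
      by (rule mult_diff_le_balanced)
  qed auto
  moreover have "minimizer n F {K. K \<subseteq> {1..n} \<and> card K = k} M X \<longleftrightarrow>
      NCD n M X \<and> joint_mix n M X \<and> has_correlation_matrix n M X (P_star n)"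
    if "k \<in> {1..n} - {1, n - 1, n}" for k
    \<comment> \<open>Excluding 1, \<open>n - 1\<close> and \<open>n\<close> leaves exactly
      \<open>2 \<le> k\<close> and \<open>k + 2 \<le> n\<close>.\<close>
    unfolding star by (rule moments[of k]) (use that in auto)
  ultimately show ?thesis by blast
qed

end
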